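(* Let $f$ be a meromorphic function on $\mathbb{C}$ whose exponent of convergence of poles $\lambda=\lambda(1/f)$ is finite, and let $\eta\neq 0$ be a fixed complex number. Then for each $\varepsilon>0$, $$N\big(r,f(z+\eta)\big)=N(r,f)+O(r^{\lambda-1+\varepsilon})+O(\log r)\qquad (r\to\infty).$$
   Context: Meromorphic means meromorphic in the whole complex plane. $n(t,f)$ is the number of poles of $f$ in $|z|\le t$, with multiplicity, and $N(r,f)=\int_0^r\frac{n(t,f)-n(0,f)}{t}\,dt+n(0,f)\log r$. $N(r,f(z+\eta))$ is the counting function of $z\mapsto f(z+\eta)$. If $(b_\mu)$ are the poles of $f$ listed with multiplicity, the exponent of convergence of poles is $\lambda(1/f)=\inf\{\tau>0:\sum_{b_\mu\ne0}|b_\mu|^{-\tau}<\infty\}$. *)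

theory Defs
  imports "HOL-Complex_Analysis.Complex_Analysis" "HOL-Library.Landau_Symbols"
begin

definition pole_mult :: "(complex \<Rightarrow> complex) \<Rightarrow> complex \<Rightarrow> nat" where
  "pole_mult f z = (if is_pole f z then nat (- zorder f z) else 0)"

(* The index set is finite for f meromorphic on the plane; for other f the sum may
   degenerate to 0. *)
definition pole_count :: "real \<Rightarrow> (complex \<Rightarrow> complex) \<Rightarrow> nat" where
  "pole_count t f = (\<Sum>z\<in>{z. is_pole f z \<and> cmod z \<le> t}. pole_mult f z)"

(* Meant for r > 0.  The integrand vanishes for small t > 0, and also at t = 0. *)
definition pole_counting_N :: "real \<Rightarrow> (complex \<Rightarrow> complex) \<Rightarrow> real" where
  "pole_counting_N r f =
     integral {0..r} (\<lambda>t. (real (pole_count t f) - real (pole_count 0 f)) / t)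
     + real (pole_count 0 f) * ln r"

(* Listing poles with multiplicity is expressed by weighting each distinct pole.
   The infimum is taken in ereal, so that it is infinite when no exponent works. *)
definition pole_conv_exponent :: "(complex \<Rightarrow> complex) \<Rightarrow> ereal" where
  "pole_conv_exponent f =
     Inf (ereal ` {\<tau>. \<tau> > 0 \<and>
       (\<lambda>b. real (pole_mult f b) * cmod b powr (- \<tau>)) summable_on {b. is_pole f b \<and> b \<noteq> 0}})"

end

theory Submission
  imports Defs "HOL-Real_Asymp.Real_Asymp"
begin

text \<open>
  Integrating the counting function gives Jensen's form
  \<open>N(r,f) = \<Sum> m(b) max(0, ln r - ln |b|)\<close>, summed over the poles \<open>b\<close> with multiplicity \<open>m(b)\<close>.
  Translation by \<open>\<eta>\<close> replaces \<open>|b|\<close> by \<open>|b - \<eta>|\<close>, which changes the term of \<open>b\<close> by at most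
  \<open>|ln |b| - ln |b - \<eta>||\<close>. This is at most \<open>2|\<eta>|/|b|\<close> once \<open>|b| \<ge> 2|\<eta>|\<close>, so up to a constant
  the difference is bounded by \<open>2|\<eta>|\<close> times the sum of \<open>m(b)/|b|\<close> over \<open>2|\<eta>| \<le> |b| \<le> r + |\<eta>|\<close>.
  Writing \<open>1/|b| = |b|\<^sup>-\<^sup>\<tau> |b|\<^sup>\<tau>\<^sup>-\<^sup>1\<close> with a convergence exponent \<open>\<tau> < \<lambda> + \<epsilon>\<close> gives
  \<open>O(1)\<close> if \<open>\<tau> \<le> 1\<close> and \<open>O(r\<^sup>\<tau>\<^sup>-\<^sup>1)\<close> otherwise.
\<close>

section \<open>Poles in discs and under translation\<close>

text \<open>Singularities of a meromorphic function are sparse, so a compact disc contains only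
  finitely many. This keeps the sums over poles from degenerating to 0.\<close>

lemma finite_poles_cball:
  assumes "f meromorphic_on UNIV"
  shows "finite {z. is_pole f z \<and> cmod z \<le> R}"
proof -
  have "{w. \<not> f analytic_on {w}} sparse_in UNIV"
    by (rule meromorphic_on_imp_sparse_singularities[OF assms])
  hence "{w. \<not> f analytic_on {w}} sparse_in cball 0 R"
    by (rule sparse_in_subset) auto
  hence "finite (cball 0 R \<inter> {w. \<not> f analytic_on {w}})"
    by (rule sparse_in_compact_finite) auto
  moreover have "{z. is_pole f z \<and> cmod z \<le> R} \<subseteq> cball 0 R \<inter> {w. \<not> f analytic_on {w}}"
    using analytic_at_imp_no_pole by auto
  ultimately show ?thesis
    by (rule rev_finite_subset)
qed

lemma is_pole_translate: "is_pole (\<lambda>z. f (z + w)) z \<longleftrightarrow> is_pole f (z + w)"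
  for f :: "complex \<Rightarrow> complex"
  by (subst (1 2) is_pole_shift_0) (simp add: add_ac)

lemma pole_mult_translate: "pole_mult (\<lambda>z. f (z + w)) z = pole_mult f (z + w)"
proof -
  have "zorder (\<lambda>z. f (z + w)) z = zorder f (z + w)"
    by (subst (1 2) zorder_shift) (simp add: add_ac)
  thus ?thesis
    by (simp add: pole_mult_def is_pole_translate)
qed

section \<open>Jensen's form of the counting function\<close>

text \<open>A simple pole of modulus \<open>a\<close> adds to n(t,f) the step function that jumps at
  \<open>a\<close>; this integral is its contribution to N(r,f).\<close>

lemma has_integral_truncated_inverse:
  fixes a r :: real
  assumes "0 < a" and "0 < r"
  shows "((\<lambda>t. if a \<le> t then 1 / t else 0) has_integral max 0 (ln r - ln a)) {0..r}"
proof (cases "a \<le> r")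
  case True
  have "((\<lambda>t. 1 / t) has_integral (ln r - ln a)) {a..r}"
    by (rule fundamental_theorem_of_calculus[OF True])
      (use assms in \<open>auto intro!: derivative_eq_intros
         simp: has_real_derivative_iff_has_vector_derivative[symmetric] field_simps\<close>)
  hence "((\<lambda>t. if t \<in> {a..r} then 1 / t else 0) has_integral (ln r - ln a)) {0..r}"
    by (subst has_integral_restrict) (use assms in auto)
  hence "((\<lambda>t. if a \<le> t then 1 / t else 0) has_integral (ln r - ln a)) {0..r}"
    by (rule has_integral_eq[rotated]) auto
  thus ?thesis
    using True assms by (simp add: max_def)
next
  case False
  have "((\<lambda>t. if a \<le> t then 1 / t else 0) has_integral 0) {0..r}"
    by (rule has_integral_is_0) (use False in auto)
  thus ?thesis
    using False assms by (simp add: max_def)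
qed

text \<open>Since \<open>ln 0 = 0\<close>, a pole at the origin needs no separate term on the right.\<close>

lemma pole_counting_N_eq_sum:
  assumes fin: "finite A" and sub: "{z. is_pole f z \<and> cmod z \<le> r} \<subseteq> A" and r: "r \<ge> 1"
  shows "pole_counting_N r f = (\<Sum>b\<in>A. real (pole_mult f b) * max 0 (ln r - ln (cmod b)))"
proof -
  let ?m = "\<lambda>b. real (pole_mult f b)"
  \<comment> \<open>A pole at 0 cancels in n(t,f) - n(0,f), so it contributes nothing to the
    integral.\<close>
  define I where "I b = (if b = 0 then 0 else max 0 (ln r - ln (cmod b)))" for b :: complex
  have count: "real (pole_count t f) = (\<Sum>b\<in>A. if cmod b \<le> t then ?m b else 0)"
    if "t \<le> r" for t
  proof -
    have "(\<Sum>b\<in>A. if cmod b \<le> t then ?m b else 0)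
        = (\<Sum>b\<in>{z. is_pole f z \<and> cmod z \<le> t}. ?m b)"
      by (rule sum.mono_neutral_cong_right)
        (use fin sub that in \<open>auto simp: pole_mult_def\<close>)
    thus ?thesis
      by (simp add: pole_count_def)
  qed
  have count0: "real (pole_count 0 f) = (\<Sum>b\<in>A. if b = 0 then ?m b else 0)"
    using r by (subst count) auto
  have "((\<lambda>t. if b \<noteq> 0 \<and> cmod b \<le> t then 1 / t else 0) has_integral I b) {0..r}" for b
    using has_integral_truncated_inverse[of "cmod b" r] r
    by (cases "b = 0") (simp_all add: I_def)
  hence "((\<lambda>t. \<Sum>b\<in>A. ?m b * (if b \<noteq> 0 \<and> cmod b \<le> t then 1 / t else 0))
      has_integral (\<Sum>b\<in>A. ?m b * I b)) {0..r}"
    by (intro has_integral_sum fin has_integral_mult_right)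
  moreover have "(\<Sum>b\<in>A. ?m b * (if b \<noteq> 0 \<and> cmod b \<le> t then 1 / t else 0))
      = (real (pole_count t f) - real (pole_count 0 f)) / t" if "t \<in> {0..r}" for t
    unfolding count0 using that
    by (subst count) (auto simp: sum_subtractf[symmetric] sum_divide_distrib intro!: sum.cong)
  ultimately have "((\<lambda>t. (real (pole_count t f) - real (pole_count 0 f)) / t)
      has_integral (\<Sum>b\<in>A. ?m b * I b)) {0..r}"
    by (rule has_integral_eq[rotated])
  hence "pole_counting_N r f
      = (\<Sum>b\<in>A. ?m b * I b) + (\<Sum>b\<in>A. if b = 0 then ?m b else 0) * ln r"
    unfolding pole_counting_N_def count0[symmetric] by (simp add: integral_unique)
  \<comment> \<open>For \<open>b = 0\<close> the factor on the right is \<open>max 0 (ln r)\<close>,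
    which equals \<open>ln r\<close> because \<open>r \<ge> 1\<close>.\<close>
  also have "\<dots> = (\<Sum>b\<in>A. ?m b * max 0 (ln r - ln (cmod b)))"
    unfolding sum_distrib_right sum.distrib[symmetric]
    by (rule sum.cong) (use r in \<open>auto simp: I_def\<close>)
  finally show ?thesis .
qed

text \<open>The poles of the translate are the points \<open>b - w\<close>. Reindexing by the poles
  of \<open>f\<close> lets both counting functions be summed over one set \<open>A\<close>.\<close>

lemma pole_counting_N_translate_eq_sum:
  assumes fin: "finite A" and sub: "{z. is_pole f z \<and> cmod (z - w) \<le> r} \<subseteq> A" and r: "r \<ge> 1"
  shows "pole_counting_N r (\<lambda>z. f (z + w))
    = (\<Sum>b\<in>A. real (pole_mult f b) * max 0 (ln r - ln (cmod (b - w))))"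
proof -
  have "pole_counting_N r (\<lambda>z. f (z + w))
      = (\<Sum>b\<in>(\<lambda>b. b - w) ` A. real (pole_mult f (b + w)) * max 0 (ln r - ln (cmod b)))"
  proof (subst pole_counting_N_eq_sum[where A = "(\<lambda>b. b - w) ` A"])
    show "{z. is_pole (\<lambda>z. f (z + w)) z \<and> cmod z \<le> r} \<subseteq> (\<lambda>b. b - w) ` A"
    proof
      fix z assume "z \<in> {z. is_pole (\<lambda>z. f (z + w)) z \<and> cmod z \<le> r}"
      hence "z + w \<in> A"
        using sub by (auto simp: is_pole_translate)
      thus "z \<in> (\<lambda>b. b - w) ` A"
        by force
    qed
  qed (use fin r in \<open>auto simp: pole_mult_translate\<close>)
  also have "\<dots> = (\<Sum>b\<in>A. real (pole_mult f b) * max 0 (ln r - ln (cmod (b - w))))"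
    by (subst sum.reindex) (auto simp: inj_on_def)
  finally show ?thesis .
qed

section \<open>Effect of a translation on the counting function\<close>

text \<open>Apply ln x - ln y \<le> (x - y)/y in both orders. The factor 2 comes from
  \<open>norm (b - w) \<ge> norm b / 2\<close>.\<close>

lemma abs_ln_norm_diff_le:
  fixes b w :: "'a :: real_normed_vector"
  assumes "w \<noteq> 0" and "2 * norm w \<le> norm b"
  shows "\<bar>ln (norm (b - w)) - ln (norm b)\<bar> \<le> 2 * norm w / norm b"
proof -
  have w: "norm w > 0"
    using assms by simp
  have tri: "norm (b - w) \<le> norm b + norm w" "norm b \<le> norm (b - w) + norm w"
    using norm_triangle_ineq4[of b w] norm_triangle_sub[of b w] by simp_all
  have pos: "norm b > 0" "norm (b - w) > 0"
    using assms w tri by linarith+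
  have "ln (norm (b - w)) - ln (norm b) \<le> (norm (b - w) - norm b) / norm b"
    using pos by (rule ln_diff_le[rotated])
  also have "\<dots> \<le> 2 * norm w / norm b"
    using tri w by (intro divide_right_mono) auto
  finally have up: "ln (norm (b - w)) - ln (norm b) \<le> 2 * norm w / norm b" .
  have "ln (norm b) - ln (norm (b - w)) \<le> (norm b - norm (b - w)) / norm (b - w)"
    using pos by (rule ln_diff_le)
  also have "\<dots> \<le> norm w / norm (b - w)"
    using tri by (intro divide_right_mono) auto
  also have "\<dots> \<le> norm w / (norm b / 2)"
    using tri assms pos by (intro divide_left_mono) auto
  finally show ?thesis
    using up by (simp add: mult.commute)
qed

lemma pole_counting_N_translate_diff_le:
  assumes mero: "f meromorphic_on UNIV" and \<eta>: "\<eta> \<noteq> 0" and r: "r \<ge> 1"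
  shows "\<bar>pole_counting_N r (\<lambda>z. f (z + \<eta>)) - pole_counting_N r f\<bar>
    \<le> (\<Sum>b | is_pole f b \<and> cmod b \<le> 2 * cmod \<eta>.
          real (pole_mult f b) * \<bar>ln (cmod (b - \<eta>)) - ln (cmod b)\<bar>)
      + 2 * cmod \<eta> * (\<Sum>b | is_pole f b \<and> 2 * cmod \<eta> \<le> cmod b \<and> cmod b \<le> r + cmod \<eta>.
          real (pole_mult f b) / cmod b)"
proof -
  let ?m = "\<lambda>b. real (pole_mult f b)"
  let ?K = "\<lambda>b. max 0 (ln r - ln (cmod b))"
  let ?d = "\<lambda>b. ?m b * \<bar>ln (cmod (b - \<eta>)) - ln (cmod b)\<bar>"
  let ?F = "{b. is_pole f b \<and> cmod b \<le> 2 * cmod \<eta>}"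
  let ?B = "{b. is_pole f b \<and> 2 * cmod \<eta> \<le> cmod b \<and> cmod b \<le> r + cmod \<eta>}"
  \<comment> \<open>This radius captures every pole \<open>b\<close> for which \<open>b\<close> or
    \<open>b - \<eta>\<close> lies in the disc of radius \<open>r\<close>.\<close>
  define A where "A = {b. is_pole f b \<and> cmod b \<le> r + cmod \<eta>}"
  have fin: "finite A" "finite ?F"
    unfolding A_def by (rule finite_poles_cball[OF mero])+
  have finB: "finite ?B"
    by (rule finite_subset[OF _ fin(1)]) (auto simp: A_def)
  have "cmod z \<le> r + cmod \<eta>" if "cmod (z - \<eta>) \<le> r" for z
    using norm_triangle_sub[of z \<eta>] that by linarith
  hence shifted: "pole_counting_N r (\<lambda>z. f (z + \<eta>)) = (\<Sum>b\<in>A. ?m b * ?K (b - \<eta>))"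
    by (intro pole_counting_N_translate_eq_sum fin r) (auto simp: A_def)
  have "pole_counting_N r f = (\<Sum>b\<in>A. ?m b * ?K b)"
    using norm_ge_zero[of \<eta>]
    by (intro pole_counting_N_eq_sum fin r) (auto simp: A_def intro: order_trans)
  with shifted have "\<bar>pole_counting_N r (\<lambda>z. f (z + \<eta>)) - pole_counting_N r f\<bar>
      = \<bar>\<Sum>b\<in>A. ?m b * (?K (b - \<eta>) - ?K b)\<bar>"
    by (simp add: sum_subtractf right_diff_distrib)
  \<comment> \<open>The map x \<mapsto> max 0 (ln r - x) is 1-Lipschitz.\<close>
  also have "\<dots> \<le> (\<Sum>b\<in>A. ?d b)"
    by (intro order_trans[OF sum_abs] sum_mono) (auto simp: abs_mult intro!: mult_left_mono)
  also have "\<dots> \<le> (\<Sum>b\<in>?F \<union> ?B. ?d b)"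
    by (intro sum_mono2) (use fin finB in \<open>auto simp: A_def\<close>)
  \<comment> \<open>Only an inequality, since \<open>?F\<close> and \<open>?B\<close> may overlap on
    the circle of radius \<open>2 * cmod \<eta>\<close>.\<close>
  also have "\<dots> \<le> (\<Sum>b\<in>?F. ?d b) + (\<Sum>b\<in>?B. ?d b)"
    by (subst sum.union_inter[symmetric]) (use fin finB in \<open>auto intro!: sum_nonneg\<close>)
  also have "(\<Sum>b\<in>?B. ?d b) \<le> (\<Sum>b\<in>?B. ?m b * (2 * cmod \<eta> / cmod b))"
    by (intro sum_mono mult_left_mono abs_ln_norm_diff_le \<eta>) auto
  also have "\<dots> = 2 * cmod \<eta> * (\<Sum>b\<in>?B. ?m b / cmod b)"
    by (simp add: sum_distrib_left mult_ac)
  finally show ?thesis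
    by simp
qed

section \<open>Use of the exponent of convergence\<close>

text \<open>On [c, R] the monotone function x powr (\<tau> - 1) is largest at an endpoint; adding
  both endpoint values covers either sign of \<open>\<tau> - 1\<close>.\<close>

lemma sum_pole_mult_div_norm_le:
  assumes mero: "f meromorphic_on UNIV" and c: "c > 0"
    and summ: "(\<lambda>b. real (pole_mult f b) * cmod b powr (- \<tau>)) summable_on {b. is_pole f b \<and> b \<noteq> 0}"
  shows "(\<Sum>b | is_pole f b \<and> c \<le> cmod b \<and> cmod b \<le> R. real (pole_mult f b) / cmod b)
    \<le> (c powr (\<tau> - 1) + R powr (\<tau> - 1))
      * (\<Sum>\<^sub>\<infinity>b\<in>{b. is_pole f b \<and> b \<noteq> 0}. real (pole_mult f b) * cmod b powr (- \<tau>))"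
proof -
  let ?g = "\<lambda>b. real (pole_mult f b) * cmod b powr (- \<tau>)"
  let ?B = "{b. is_pole f b \<and> c \<le> cmod b \<and> cmod b \<le> R}"
  let ?M = "c powr (\<tau> - 1) + R powr (\<tau> - 1)"
  have fin: "finite ?B"
    by (rule finite_subset[OF _ finite_poles_cball[OF mero, of R]]) auto
  have "real (pole_mult f b) / cmod b \<le> ?M * ?g b" if "b \<in> ?B" for b
  proof -
    have b: "cmod b > 0" "c \<le> cmod b" "cmod b \<le> R"
      using that c by auto
    have "cmod b powr (\<tau> - 1) \<le> ?M"
    proof (cases "\<tau> \<ge> 1")
      case True
      hence "cmod b powr (\<tau> - 1) \<le> R powr (\<tau> - 1)"
        using b by (intro powr_mono2) auto
      thus ?thesis
        by (simp add: add_increasing)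
    next
      case False
      hence "cmod b powr (\<tau> - 1) \<le> c powr (\<tau> - 1)"
        using b c by (intro powr_mono2') auto
      thus ?thesis
        by (simp add: add_increasing2)
    qed
    hence "cmod b powr (\<tau> - 1) * ?g b \<le> ?M * ?g b"
      by (rule mult_right_mono) auto
    moreover have "cmod b powr (\<tau> - 1) * cmod b powr (- \<tau>) = 1 / cmod b"
      using b powr_add[of "cmod b" "\<tau> - 1" "- \<tau>"] by (simp add: powr_minus_divide)
    hence "cmod b powr (\<tau> - 1) * ?g b = real (pole_mult f b) / cmod b"
      by (simp add: mult.left_commute)
    ultimately show ?thesis
      by simp
  qed
  hence "(\<Sum>b\<in>?B. real (pole_mult f b) / cmod b) \<le> ?M * (\<Sum>b\<in>?B. ?g b)"
    unfolding sum_distrib_left by (rule sum_mono)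
  also have "\<dots> \<le> ?M * (\<Sum>\<^sub>\<infinity>b\<in>{b. is_pole f b \<and> b \<noteq> 0}. ?g b)"
    by (intro mult_left_mono finite_sum_le_infsum summ fin) (use c in auto)
  finally show ?thesis .
qed

text \<open>The infimum need not be attained; \<open>\<epsilon>\<close> provides the slack. Being
  nonnegative and below infinity, it is a real number, so \<open>real_of_ereal\<close> keeps its
  value.\<close>

lemma pole_conv_exponent_less_obtain:
  assumes fin: "pole_conv_exponent f < \<infinity>" and "\<epsilon> > 0"
  obtains \<tau> where "\<tau> < real_of_ereal (pole_conv_exponent f) + \<epsilon>"
    and "(\<lambda>b. real (pole_mult f b) * cmod b powr (- \<tau>)) summable_on {b. is_pole f b \<and> b \<noteq> 0}"
proof -
  have "pole_conv_exponent f \<ge> 0"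
    unfolding pole_conv_exponent_def by (rule Inf_greatest) auto
  with fin obtain l where l: "pole_conv_exponent f = ereal l"
    by (cases "pole_conv_exponent f") auto
  hence "pole_conv_exponent f < ereal (l + \<epsilon>)"
    using \<open>\<epsilon> > 0\<close> by simp
  then obtain \<tau> where "ereal \<tau> < ereal (l + \<epsilon>)"
    "(\<lambda>b. real (pole_mult f b) * cmod b powr (- \<tau>)) summable_on {b. is_pole f b \<and> b \<noteq> 0}"
    unfolding pole_conv_exponent_def[of f] Inf_less_iff by auto
  thus ?thesis
    using that l by simp
qed

section \<open>The error terms\<close>

theorem theorem2p2:
  fixes f :: "complex \<Rightarrow> complex" and \<eta> :: complex and \<epsilon> :: real
  assumes "f meromorphic_on UNIV"
    and "pole_conv_exponent f < \<infinity>"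
    and "\<eta> \<noteq> 0"
    and "\<epsilon> > 0"
  shows "\<exists>E1 E2 :: real \<Rightarrow> real.
           E1 \<in> O[at_top](\<lambda>r. r powr (real_of_ereal (pole_conv_exponent f) - 1 + \<epsilon>)) \<and>
           E2 \<in> O[at_top](\<lambda>r. ln r) \<and>
           (\<forall>\<^sub>F r in at_top.
              pole_counting_N r (\<lambda>z. f (z + \<eta>)) = pole_counting_N r f + E1 r + E2 r)"
proof -
  define D where "D r = pole_counting_N r (\<lambda>z. f (z + \<eta>)) - pole_counting_N r f" for r
  define h where "h = cmod \<eta>"
  have h: "h > 0"
    using assms by (simp add: h_def)
  obtain \<tau> where \<tau>: "\<tau> < real_of_ereal (pole_conv_exponent f) + \<epsilon>"
    and summ: "(\<lambda>b. real (pole_mult f b) * cmod b powr (- \<tau>)) summable_on {b. is_pole f b \<and> b \<noteq> 0}"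
    using pole_conv_exponent_less_obtain assms by blast
  define C where "C = (\<Sum>b | is_pole f b \<and> cmod b \<le> 2 * h.
    real (pole_mult f b) * \<bar>ln (cmod (b - \<eta>)) - ln (cmod b)\<bar>)"
  define S where "S = (\<Sum>\<^sub>\<infinity>b\<in>{b. is_pole f b \<and> b \<noteq> 0}. real (pole_mult f b) * cmod b powr (- \<tau>))"
  have bound: "\<bar>D r\<bar> \<le> C + 2 * h * (((2 * h) powr (\<tau> - 1) + (r + h) powr (\<tau> - 1)) * S)"
    if "r \<ge> 1" for r
  proof -
    have "\<bar>D r\<bar> \<le> C + 2 * h * (\<Sum>b | is_pole f b \<and> 2 * h \<le> cmod b \<and> cmod b \<le> r + h.
        real (pole_mult f b) / cmod b)"
      unfolding D_def C_def h_def
      by (rule pole_counting_N_translate_diff_le) (use assms that in auto)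
    also have "\<dots> \<le> C + 2 * h * (((2 * h) powr (\<tau> - 1) + (r + h) powr (\<tau> - 1)) * S)"
      unfolding S_def
      by (intro add_left_mono mult_left_mono sum_pole_mult_div_norm_le assms(1) summ) (use h in auto)
    finally show ?thesis .
  qed
  have D: "D \<in> O(\<lambda>r. C + 2 * h * (((2 * h) powr (\<tau> - 1) + (r + h) powr (\<tau> - 1)) * S))"
    by (rule landau_o.big_mono)
      (use bound in \<open>force intro!: eventually_at_top_linorderI[of 1]\<close>)
  show ?thesis
  \<comment> \<open>All of \<open>D\<close> goes into one error term and the other is zero:
    \<open>E2 = D\<close> if \<open>\<tau> \<le> 1\<close>, and \<open>E1 = D\<close>
    otherwise.\<close>
  proof (cases "\<tau> \<le> 1")
    case True
    \<comment> \<open>For \<open>r \<ge> 1\<close> the base exceeds 1 and the exponent is at most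
      0.\<close>
    have "(\<lambda>r. (r + h) powr (\<tau> - 1)) \<in> O(\<lambda>_. 1)"
      using True h powr_mono[of "\<tau> - 1" 0]
      by (intro landau_o.big_mono eventually_at_top_linorderI[of 1]) auto
    hence "(\<lambda>r. C + 2 * h * (((2 * h) powr (\<tau> - 1) + (r + h) powr (\<tau> - 1)) * S)) \<in> O(\<lambda>_. 1)"
      by (intro sum_in_bigo landau_o.big.mult_in_1) auto
    also have "(\<lambda>_. 1) \<in> O(\<lambda>r. ln r :: real)"
      by real_asymp
    finally have "D \<in> O(\<lambda>r. ln r)"
      using D landau_o.big_trans by blast
    thus ?thesis
      by (intro exI[of _ "\<lambda>_. 0"] exI[of _ D]) (simp add: D_def)
  next
    case False
    define s where "s = \<tau> - 1"
    have s: "s > 0"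
      using False by (simp add: s_def)
    have "(\<lambda>r. (r + h) powr s) \<in> O(\<lambda>r. r powr s)"
      using s h by real_asymp
    \<comment> \<open>Since \<open>s > 0\<close>, the power of \<open>r\<close> absorbs the constant
      \<open>C\<close> and the endpoint value at \<open>2 * h\<close>.\<close>
    moreover have const: "(\<lambda>_. a) \<in> O(\<lambda>r. r powr s)" for a :: real
      using s by real_asymp
    ultimately have "(\<lambda>r. (2 * h) powr s + (r + h) powr s) \<in> O(\<lambda>r. r powr s)"
      by (intro sum_in_bigo)
    hence "(\<lambda>r. C + 2 * h * (((2 * h) powr s + (r + h) powr s) * S)) \<in> O(\<lambda>r. r powr s)"
      by (intro sum_in_bigo const) auto
    also have "(\<lambda>r. r powr s) \<in> O(\<lambda>r. r powr (real_of_ereal (pole_conv_exponent f) - 1 + \<epsilon>))"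
      using \<tau> by (intro landau_o.big_mono eventually_at_top_linorderI[of 1])
        (auto simp: s_def intro!: powr_mono)
    finally have "D \<in> O(\<lambda>r. r powr (real_of_ereal (pole_conv_exponent f) - 1 + \<epsilon>))"
      using D landau_o.big_trans unfolding s_def by blast
    thus ?thesis
      by (intro exI[of _ D] exI[of _ "\<lambda>_. 0"]) (simp add: D_def)
  qed
qed

end
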